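(* Let $G=(V,E)$ be a finite simple graph and let $E=E_1\sqcup E_2$ be a partition of its edge set into two (possibly empty) colour classes. If \[ |E|+\min\{|E_1|,|E_2|\}>\binom{|V|}{2}, \] then $G$ contains a non-monochromatic triangle, i.e. a subgraph isomorphic to $K_3$ containing at least one edge of $E_1$ and at least one edge of $E_2$.
   Context: A triangle in a graph is a subgraph isomorphic to the complete graph $K_3$. A subgraph is monochromatic if all of its edges lie in a single colour class, and non-monochromatic otherwise. *)

theory Defs
  imports "HOL-Library.Ramsey"
begin

text \<open>A finite simple graph is a pair of a finite vertex set and a set of edges, an edge being a
  two-element set of vertices; \<^term>\<open>nsets V 2\<close> is the set of two-element subsets of \<open>V\<close>.\<close>

definition simple_graph :: "'a set \<Rightarrow> 'a set set \<Rightarrow> bool" where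
  "simple_graph V E \<longleftrightarrow> finite V \<and> E \<subseteq> nsets V 2"

definition subgraph_of :: "'a set \<Rightarrow> 'a set set \<Rightarrow> 'a set \<Rightarrow> 'a set set \<Rightarrow> bool" where
  "subgraph_of W F V E \<longleftrightarrow> simple_graph W F \<and> W \<subseteq> V \<and> F \<subseteq> E"

definition graph_isomorphic :: "'a set \<Rightarrow> 'a set set \<Rightarrow> 'b set \<Rightarrow> 'b set set \<Rightarrow> bool" where
  "graph_isomorphic V E V' E' \<longleftrightarrow>
     (\<exists>f. bij_betw f V V' \<and> (\<forall>x\<in>V. \<forall>y\<in>V. {x, y} \<in> E \<longleftrightarrow> {f x, f y} \<in> E'))"

text \<open>The complete graph on \<open>n\<close> vertices has vertex set \<^term>\<open>{..<n::nat}\<close> and edge set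
  \<open>K_edges n\<close>.\<close>

definition K_edges :: "nat \<Rightarrow> nat set set" where
  "K_edges n = nsets {..<n} 2"

definition triangle_in :: "'a set \<Rightarrow> 'a set set \<Rightarrow> 'a set \<Rightarrow> 'a set set \<Rightarrow> bool" where
  "triangle_in W F V E \<longleftrightarrow> subgraph_of W F V E \<and> graph_isomorphic W F {..<3} (K_edges 3)"

text \<open>Here \<open>\<C>\<close> is the collection of colour classes and \<open>F\<close> the edge set of a subgraph.\<close>

definition monochromatic_edges :: "'a set set set \<Rightarrow> 'a set set \<Rightarrow> bool" where
  "monochromatic_edges \<C> F \<longleftrightarrow> (\<exists>C\<in>\<C>. F \<subseteq> C)"

end

theory Submission imports Defs begin

text \<open>Colour the pairs of vertices that are not edges green. If no triangle uses both red and blue,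
  then a red and a blue edge sharing a vertex always span a green pair. Let \<open>v\<close> have minimum green
  degree \<open>g\<close>, let \<open>S\<close>, \<open>U\<close>, \<open>T\<close> be its red, blue and green neighbourhoods, and assume
  \<open>r = |S| \<ge> b = |U|\<close>. All of \<open>S \<times> U\<close> is green, \<open>S\<close> contains no blue pair, and the blue
  neighbours in \<open>S\<close> of any \<open>t \<in> T\<close> form a green clique; let \<open>h\<close> be the largest size of such a
  clique. Counting the green pairs from below and the blue pairs from above then gives
  \<open>|B| \<le> |G|\<close> if \<open>h \<le> r - b\<close>, and \<open>3 |G| \<ge> |R| + |B| + |G|\<close> if \<open>h > r - b\<close>.\<close>

section \<open>Counting pairs in finite relations\<close>

text \<open>Grouping pairs by their first entry turns a count into a sum of degrees. It serves for
  the green degrees over \<open>T\<close> and for the blue degrees from \<open>T\<close> into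
  \<open>S\<close>.\<close>

lemma card_Image_sum:
  assumes "finite A" "finite X" shows "card (X \<inter> A \<times> C) = (\<Sum>t\<in>A. card (X `` {t} \<inter> C))"
proof -
  have "X \<inter> A \<times> C = Sigma A (\<lambda>t. X `` {t} \<inter> C)"
    by auto
  moreover have "finite (X `` {t})" for t
    using assms(2) by (simp add: finite_Image)
  ultimately show ?thesis
    using assms by simp
qed

lemma card_flip:
  assumes "sym X" shows "card (X \<inter> A \<times> C) = card (X \<inter> C \<times> A)"
proof -
  have "X \<inter> C \<times> A = prod.swap ` (X \<inter> A \<times> C)"
    using assms by (fastforce dest: symD)
  then show ?thesis
    by (simp add: card_image)
qed

lemma card_off_diagonal:
  assumes "finite A" shows "card (A \<times> A - Id) + card A = card A * card A"
proof -
  have "A \<times> A = (A \<times> A - Id) \<union> (\<lambda>x. (x, x)) ` A"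
    by auto
  moreover have "card ((A \<times> A - Id) \<union> (\<lambda>x. (x, x)) ` A)
      = card (A \<times> A - Id) + card ((\<lambda>x. (x, x)) ` A)"
    using assms by (intro card_Un_disjoint) auto
  ultimately show ?thesis
    by (simp add: card_image inj_on_def card_cartesian_product)
qed

section \<open>Three-coloured complete graphs without a red-blue triangle\<close>

locale red_blue_green =
  fixes V :: "'a set" and R B G :: "('a \<times> 'a) set"
  assumes fin: "finite V"
    and sym: "sym R" "sym B" "sym G"
    and disj: "R \<inter> B = {}" "R \<inter> G = {}" "B \<inter> G = {}"
    and cover: "R \<union> B \<union> G = V \<times> V - Id"
    and red_blue: "R O B \<subseteq> G"
begin

lemma flip:
  "(x, y) \<in> R \<longleftrightarrow> (y, x) \<in> R" "(x, y) \<in> B \<longleftrightarrow> (y, x) \<in> B" "(x, y) \<in> G \<longleftrightarrow> (y, x) \<in> G"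
  using sym by (auto dest: symD)

lemma blue_red: "B O R \<subseteq> G"
  using red_blue flip by blast

lemma swap_colours: "red_blue_green V B R G"
  by unfold_locales (use fin sym disj cover blue_red in auto)

lemma finite_colour: "finite R" "finite B" "finite G"
  using cover fin by (metis finite_Diff finite_SigmaI finite_Un)+

text \<open>Either alternative bounds the smaller of \<open>card R\<close> and \<open>card B\<close>
  by \<open>card G\<close>. The assumption \<open>le\<close> costs no generality, since
  \<open>swap_colours\<close> exchanges red and blue and leaves \<open>G\<close> fixed.\<close>

lemma blue_le_or_average:
  assumes v: "v \<in> V" and min: "\<And>x. x \<in> V \<Longrightarrow> card (G `` {v}) \<le> card (G `` {x})"
    and le: "card (B `` {v}) \<le> card (R `` {v})"
  shows "card B \<le> card G \<or> card R + card B \<le> 2 * card G"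
proof -
  define S U T where defs: "S = R `` {v}" "U = B `` {v}" "T = G `` {v}"
  define r b g where cards: "r = card S" "b = card U" "g = card T"
  have V: "V = insert v (S \<union> U \<union> T)"
    using v cover unfolding defs by blast
  have vn: "v \<notin> S" "v \<notin> U" "v \<notin> T"
    using cover unfolding defs by blast+
  have dj: "S \<inter> U = {}" "S \<inter> T = {}" "U \<inter> T = {}"
    using disj unfolding defs by blast+
  have fins: "finite S" "finite U" "finite T"
    using fin V by (metis finite_insert finite_Un)+
  have n: "card V = 1 + r + b + g"
    unfolding V cards using vn dj fins by (simp add: card_Un_disjoint Int_Un_distrib2)
  have SU: "S \<times> U \<subseteq> G" "U \<times> S \<subseteq> G"
    using red_blue flip unfolding defs by blast+
  \<comment> \<open>For \<open>x\<close>, \<open>y\<close> in \<open>S\<close> with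
    \<open>(x, y)\<close> blue, the red pair \<open>(v, x)\<close> would force \<open>(v, y)\<close>
    to be green, but it is red.\<close>
  have S_no_blue: "B \<inter> S \<times> S = {}"
    using red_blue disj unfolding defs by blast
  have clique: "(B `` {t} \<inter> S) \<times> (B `` {t} \<inter> S) - Id \<subseteq> G" if "t \<in> T" for t
  proof -
    \<comment> \<open>If \<open>(x, y)\<close> were red, the blue pair \<open>(t, x)\<close> would
      force \<open>(t, y)\<close> to be green, but it is blue.\<close>
    have "(x, y) \<notin> R" if "(t, x) \<in> B" "(t, y) \<in> B" for x y
      using blue_red disj(3) that by blast
    moreover have "S \<subseteq> V"
      using V by blast
    ultimately show ?thesis
      using S_no_blue cover by blast
  qed
  obtain H where H: "H \<subseteq> S" "H \<times> H - Id \<subseteq> G" "\<And>t. t \<in> T \<Longrightarrow> card (B `` {t} \<inter> S) \<le> card H"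
  proof (cases "T = {}")
    case True
    then show ?thesis
      using that[of "{}"] by simp
  next
    case False
    let ?d = "\<lambda>t. card (B `` {t} \<inter> S)"
    have "Max (?d ` T) \<in> ?d ` T"
      using fins(3) False by (intro Max_in) auto
    then obtain t where t: "t \<in> T" "Max (?d ` T) = ?d t"
      by (rule imageE) (rule that)
    have "?d s \<le> ?d t" if "s \<in> T" for s
      unfolding t(2)[symmetric] using fins(3) that by (intro Max_ge) auto
    then show ?thesis
      using that[OF Int_lower2 clique[OF t(1)]] by blast
  qed
  define h where "h = card H"
  have finH: "finite H"
    using H(1) fins(1) finite_subset by blast

  \<comment> \<open>Minimality of \<open>g\<close> bounds \<open>GT\<close> from below. By symmetry,
    the green pairs meeting \<open>T\<close> number \<open>2 * GT - gT\<close>.\<close>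
  define GT where "GT = card (G \<inter> T \<times> V)"
  define gT where "gT = card (G \<inter> T \<times> T)"
  have GT_ge: "g * g \<le> GT"
  proof -
    have "G `` {t} \<inter> V = G `` {t}" for t
      using cover by blast
    then have "GT = (\<Sum>t\<in>T. card (G `` {t}))"
      unfolding GT_def using card_Image_sum[OF fins(3) finite_colour(3), of V] by simp
    also have "\<dots> \<ge> (\<Sum>t\<in>T. g)"
      using min V unfolding cards defs by (intro sum_mono) blast
    finally show ?thesis
      by (simp add: cards)
  qed
  have GT_split: "GT = gT + card (G \<inter> (V - T) \<times> T)"
  proof -
    have "G \<inter> T \<times> V = (G \<inter> T \<times> T) \<union> (G \<inter> T \<times> (V - T))"
      using V by blast
    moreover have "card ((G \<inter> T \<times> T) \<union> (G \<inter> T \<times> (V - T)))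
        = card (G \<inter> T \<times> T) + card (G \<inter> T \<times> (V - T))"
      using finite_colour by (intro card_Un_disjoint) auto
    ultimately show ?thesis
      unfolding GT_def gT_def using card_flip[OF sym(3), of T "V - T"] by simp
  qed
  \<comment> \<open>The five blocks are disjoint because \<open>S\<close>, \<open>U\<close> and
    \<open>T\<close> are and \<open>H \<subseteq> S\<close>; the last two contain all green pairs
    that meet \<open>T\<close>.\<close>
  have green: "2 * r * b + card (H \<times> H - Id) + GT + card (G \<inter> (V - T) \<times> T) \<le> card G"
  proof -
    have "card (S \<times> U \<union> U \<times> S \<union> (H \<times> H - Id) \<union> G \<inter> T \<times> V \<union> G \<inter> (V - T) \<times> T)
        = card (S \<times> U) + card (U \<times> S) + card (H \<times> H - Id) + GT + card (G \<inter> (V - T) \<times> T)"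
      unfolding GT_def using fins finH finite_colour dj H(1)
      by (subst card_Un_disjoint, simp, simp, blast)+ simp
    moreover have "\<dots> = 2 * r * b + card (H \<times> H - Id) + GT + card (G \<inter> (V - T) \<times> T)"
      by (simp add: cards card_cartesian_product)
    moreover have "S \<times> U \<union> U \<times> S \<union> (H \<times> H - Id) \<union> G \<inter> T \<times> V \<union> G \<inter> (V - T) \<times> T \<subseteq> G"
      using SU H(2) by blast
    ultimately show ?thesis
      using card_mono[OF finite_colour(3)] by metis
  qed

  define bT where "bT = card (B \<inter> T \<times> T)"
  \<comment> \<open>Bounding the sum is what matters: subtracting the blue bound from the green one
    leaves exactly \<open>- (gT + bT)\<close> from the pairs inside \<open>T\<close>.\<close>
  have TT: "gT + bT \<le> card (T \<times> T - Id)"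
  proof -
    have "gT + bT = card (G \<inter> T \<times> T \<union> B \<inter> T \<times> T)"
      unfolding gT_def bT_def using finite_colour disj
      by (intro card_Un_disjoint[symmetric]) auto
    also have "\<dots> \<le> card (T \<times> T - Id)"
      using fins cover by (intro card_mono) auto
    finally show ?thesis .
  qed
  have TS: "card (B \<inter> T \<times> S) \<le> g * h"
  proof -
    have "(\<Sum>t\<in>T. card (B `` {t} \<inter> S)) \<le> (\<Sum>t\<in>T. h)"
      unfolding h_def using H(3) by (intro sum_mono)
    then show ?thesis
      by (simp add: card_Image_sum[OF fins(3) finite_colour(2)] cards)
  qed
  have blue: "card B \<le> 2 * b + card (U \<times> U - Id) + bT + 2 * (g * h) + 2 * (g * b)"
  proof -
    \<comment> \<open>The blocks missing from the cover hold no blue pair: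
      \<open>S \<times> S\<close> by \<open>S_no_blue\<close>, \<open>S \<times> U\<close> and
      \<open>U \<times> S\<close> because they are green, and \<open>v\<close> has blue neighbours
      only in \<open>U\<close>.\<close>
    have "B \<subseteq> {v} \<times> U \<union> U \<times> {v} \<union> (U \<times> U - Id) \<union> B \<inter> T \<times> T
        \<union> B \<inter> T \<times> S \<union> B \<inter> S \<times> T \<union> T \<times> U \<union> U \<times> T" (is "_ \<subseteq> ?C")
    proof (rule subrelI)
      fix x y
      assume xy: "(x, y) \<in> B"
      then have "x \<in> insert v (S \<union> U \<union> T)" "y \<in> insert v (S \<union> U \<union> T)" "x \<noteq> y"
        using cover V by blast+
      moreover have "x = v \<Longrightarrow> y \<in> U" "y = v \<Longrightarrow> x \<in> U"
        using xy sym(2) unfolding defs by (auto dest: symD)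
      moreover have "\<not> (x \<in> S \<and> y \<in> S)" "\<not> (x \<in> S \<and> y \<in> U)" "\<not> (x \<in> U \<and> y \<in> S)"
        using xy S_no_blue SU disj(3) by blast+
      ultimately show "(x, y) \<in> ?C"
        using xy by auto
    qed
    then have "card B \<le> card ?C"
      using fins finite_colour by (intro card_mono) auto
    also have "\<dots> \<le> card ({v} \<times> U) + card (U \<times> {v}) + card (U \<times> U - Id) + card (B \<inter> T \<times> T)
        + card (B \<inter> T \<times> S) + card (B \<inter> S \<times> T) + card (T \<times> U) + card (U \<times> T)"
      by (intro card_Un_le[THEN order_trans] add_mono order_refl)
    also have "\<dots> \<le> 2 * b + card (U \<times> U - Id) + bT + 2 * (g * h) + 2 * (g * b)"
      using TS card_flip[OF sym(2), of T S]
      by (simp add: cards bT_def card_cartesian_product mult.commute)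
    finally show ?thesis .
  qed

  have total: "card R + card B + card G + card V = card V * card V"
  proof -
    have "card (R \<union> B \<union> G) = card R + card B + card G"
      using disj finite_colour by (simp add: card_Un_disjoint Int_Un_distrib2)
    then show ?thesis
      using card_off_diagonal[OF fin] cover by simp
  qed

  \<comment> \<open>These are integers because \<open>w\<close> may be negative. Measuring
    \<open>r\<close> and \<open>g\<close> from \<open>b\<close> reduces both cases to products of
    consecutive integers.\<close>
  define D w k where "D = int r - int b" and "w = int g - int b" and "k = int h"
  have D: "D \<ge> 0"
    using le unfolding D_def cards defs by simp
  have subst: "int r = D + int b" "int g = w + int b" "int h = k"
    unfolding D_def w_def k_def by auto
  have "int (card (H \<times> H - Id)) = k * k - k" "int (card (T \<times> T - Id)) = int g * int g - int g"
    "int (card (U \<times> U - Id)) = int b * int b - int b"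
    using card_off_diagonal[OF finH] card_off_diagonal[OF fins(3)] card_off_diagonal[OF fins(2)]
    unfolding h_def[symmetric] cards[symmetric] k_def
    by (metis add_diff_cancel_right' of_nat_add of_nat_mult)+
  note sq = this
  have I: "2 * int r * int b + (k * k - k) + 2 * int GT - int gT \<le> int (card G)"
    "int g * int g \<le> int GT" "int gT + int bT \<le> int g * int g - int g"
    "int (card B) \<le> 2 * int b + (int b * int b - int b) + int bT + 2 * (int g * k)
       + 2 * (int g * int b)"
    using GT_split green[THEN zle_int[THEN iffD2]] GT_ge[THEN zle_int[THEN iffD2]]
      TT[THEN zle_int[THEN iffD2]] blue[THEN zle_int[THEN iffD2]]
    by (simp_all add: sq subst(3))
  \<comment> \<open>Integrality matters: the inequality fails for reals strictly between -1 and
    0.\<close>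
  have consecutive: "x * x + x \<ge> 0" for x :: int
  proof (cases "x \<ge> 0")
    case False
    then show ?thesis
      using mult_nonpos_nonpos[of x "x + 1"] by (simp add: algebra_simps)
  qed simp
  show ?thesis
  proof (cases "k \<le> D")
    case True
    have "int (card G) - int (card B) \<ge> (w - k) * (w - k) + (w - k) + 2 * (int b * (D - k))"
      using I unfolding subst by (simp add: algebra_simps)
    moreover have "int b * (D - k) \<ge> 0"
      using True by simp
    ultimately show ?thesis
      using consecutive[of "w - k"] by linarith
  next
    case False
    have "int bT \<ge> 0"
      by simp
    then have "int (card G) \<ge> 2 * int r * int b + (k * k - k) + int g * int g + int g"
      using I by linarith
    moreover have "int (card R) + int (card B) + int (card G)
        = (1 + int r + int b + int g) * (int r + int b + int g)"
    proof -
      have "int (card R + card B + card G + card V) = int (card V * card V)"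
        using total by simp
      then show ?thesis
        by (simp add: n algebra_simps)
    qed
    \<comment> \<open>The left side is \<open>3 * card G\<close> minus the number of all ordered
      pairs of distinct vertices.\<close>
    ultimately have "2 * int (card G) - int (card R) - int (card B)
        \<ge> 2 * (w * w) - 2 * (D * w) - D * D + 2 * w - D + 3 * (k * k - k)"
      unfolding subst by (simp add: algebra_simps)
    \<comment> \<open>As \<open>k > D\<close> are integers, \<open>k \<ge> D + 1\<close>. The lower
      bound then splits into \<open>(w - D) * (w - D) + (w - D)\<close>, \<open>w * w + w\<close>,
      \<open>D * D + D\<close> and \<open>2 * D\<close>, all nonnegative.\<close>
    moreover have "k * k - k \<ge> D * D + D"
      using mult_mono[of "D + 1" k D "k - 1"] False D by (simp add: algebra_simps)
    moreover have "w * w - 2 * (D * w) + D * D + w - D \<ge> 0"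
      using consecutive[of "w - D"] by (simp add: algebra_simps)
    ultimately have "int (card R) + int (card B) \<le> 2 * int (card G)"
      using consecutive[of w] consecutive[of D] D by (smt (verit))
    then show ?thesis
      by linarith
  qed
qed

theorem red_or_blue_le_green: "card R \<le> card G \<or> card B \<le> card G"
proof (cases "V = {}")
  case True
  then show ?thesis
    using cover by simp
next
  case False
  then obtain v where v: "v \<in> V" "\<And>x. x \<in> V \<Longrightarrow> card (G `` {v}) \<le> card (G `` {x})"
    using that[OF arg_min_if_finite(1)[OF fin] arg_min_least[OF fin]] by blast
  show ?thesis
  proof (cases "card (B `` {v}) \<le> card (R `` {v})")
    case True
    then show ?thesis
      using blue_le_or_average[OF v] by linarith
  next
    case False
    interpret swapped: red_blue_green V B R G
      by (rule swap_colours)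
    show ?thesis
      using swapped.blue_le_or_average[OF v] False by linarith
  qed
qed

end

section \<open>From edge sets to relations and triangles\<close>

definition ordered_pairs :: "'a set set \<Rightarrow> ('a \<times> 'a) set" where
  "ordered_pairs E = {(x, y). {x, y} \<in> E}"

text \<open>Each edge has two distinct ends and so two orientations. The common factor 2 cancels
  when colour classes are compared.\<close>

lemma card_ordered_pairs:
  assumes "finite V" "E \<subseteq> nsets V 2" shows "card (ordered_pairs E) = 2 * card E"
proof -
  have finE: "finite E"
    using assms finite_imp_finite_nsets finite_subset by metis
  have two: "card {(x, y). {x, y} = e} = 2 \<and> finite {(x, y). {x, y} = e}" if "e \<in> E" for e
  proof -
    obtain a b where ab: "e = {a, b}" "a \<noteq> b"
      using subsetD[OF assms(2) \<open>e \<in> E\<close>] by (auto simp: nsets_def card_2_iff)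
    then have "{(x, y). {x, y} = e} = {(a, b), (b, a)}"
      by (auto simp: doubleton_eq_iff)
    then show ?thesis
      using ab by simp
  qed
  have "ordered_pairs E = (\<Union>e\<in>E. {(x, y). {x, y} = e})"
    by (auto simp: ordered_pairs_def)
  also have "card \<dots> = (\<Sum>e\<in>E. card {(x, y). {x, y} = e})"
    using finE two by (intro card_UN_disjoint) auto
  finally show ?thesis
    using two by simp
qed

lemma graph_isomorphic_complete:
  assumes "finite W" shows "graph_isomorphic W (nsets W 2) {..<card W} (K_edges (card W))"
proof -
  obtain f where f: "bij_betw f W {..<card W}"
    using ex_bij_betw_finite_nat[OF assms] by (auto simp: atLeast0LessThan)
  then have "{x, y} \<in> nsets W 2 \<longleftrightarrow> {f x, f y} \<in> K_edges (card W)" if "x \<in> W" "y \<in> W" for x y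
    using that bij_betw_apply[OF f] unfolding K_edges_def
    by (auto simp: bij_betw_def inj_on_eq_iff)
  then show ?thesis
    unfolding graph_isomorphic_def using f by blast
qed

lemma triangle_in_complete:
  assumes "W \<subseteq> V" "card W = 3" "nsets W 2 \<subseteq> E" shows "triangle_in W (nsets W 2) V E"
proof -
  have "finite W"
    using assms(2) card.infinite by fastforce
  then show ?thesis
    using assms graph_isomorphic_complete[of W]
    by (simp add: triangle_in_def subgraph_of_def simple_graph_def)
qed

theorem theorem1p2:
  fixes V :: "'a set" and E E1 E2 :: "'a set set"
  assumes "simple_graph V E"
    and "E = E1 \<union> E2" and "E1 \<inter> E2 = {}"
    and "card E + min (card E1) (card E2) > card V choose 2"
  shows "\<exists>W F. triangle_in W F V E \<and> \<not> monochromatic_edges {E1, E2} F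
               \<and> F \<inter> E1 \<noteq> {} \<and> F \<inter> E2 \<noteq> {}"
proof (rule ccontr)
  assume none: "\<not> ?thesis"
  define N where "N = nsets V 2 - E"
  have fin: "finite V" and sub: "E1 \<subseteq> nsets V 2" "E2 \<subseteq> nsets V 2" "N \<subseteq> nsets V 2"
    using assms(1,2) by (auto simp: simple_graph_def N_def)
  have all: "E1 \<union> E2 \<union> N = nsets V 2"
    using sub assms(2) by (auto simp: N_def)
  \<comment> \<open>If \<open>{x, z}\<close> were an edge, \<open>x\<close>, \<open>y\<close>,
    \<open>z\<close> would span a triangle with an edge in each class. Here
    \<open>x \<noteq> z\<close>, since otherwise one edge would lie in both classes.\<close>
  have no_triangle: "{x, z} \<in> N" if xy: "{x, y} \<in> E1" and yz: "{y, z} \<in> E2" for x y z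
  proof (rule ccontr)
    assume "{x, z} \<notin> N"
    moreover have "x \<noteq> z"
      using xy yz assms(3) by (auto simp: insert_commute)
    moreover have dist: "x \<in> V" "y \<in> V" "z \<in> V" "x \<noteq> y" "y \<noteq> z"
      using subsetD[OF sub(1) xy] subsetD[OF sub(2) yz] by auto
    ultimately have xz: "{x, z} \<in> E"
      by (simp add: N_def)
    let ?W = "{x, y, z}"
    have K: "nsets ?W 2 = {{x, y}, {y, z}, {x, z}}"
      using dist \<open>x \<noteq> z\<close> by (auto simp: nsets_2_eq insert_commute)
    have "triangle_in ?W (nsets ?W 2) V E"
      using xz xy yz dist \<open>x \<noteq> z\<close> assms(2) by (intro triangle_in_complete) (auto simp: K)
    moreover have "\<not> monochromatic_edges {E1, E2} (nsets ?W 2)"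
      using xy yz assms(3) by (auto simp: monochromatic_edges_def K)
    moreover have "nsets ?W 2 \<inter> E1 \<noteq> {}" "nsets ?W 2 \<inter> E2 \<noteq> {}"
      using xy yz by (auto simp: K)
    ultimately show False
      using none by blast
  qed
  interpret red_blue_green V "ordered_pairs E1" "ordered_pairs E2" "ordered_pairs N"
  proof
    show "ordered_pairs E1 \<union> ordered_pairs E2 \<union> ordered_pairs N = V \<times> V - Id"
    proof -
      have "ordered_pairs E1 \<union> ordered_pairs E2 \<union> ordered_pairs N = ordered_pairs (nsets V 2)"
        unfolding all[symmetric] by (auto simp: ordered_pairs_def)
      then show ?thesis
        by (auto simp: ordered_pairs_def)
    qed
    show "ordered_pairs E1 O ordered_pairs E2 \<subseteq> ordered_pairs N"
      using no_triangle by (auto simp: ordered_pairs_def)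
  qed (use fin assms(2,3) in \<open>auto simp: ordered_pairs_def N_def sym_def insert_commute\<close>)
  \<comment> \<open>Thus the smaller class has at most \<open>card N\<close> edges, and
    \<open>card E + card N\<close> is exactly the binomial coefficient that the hypothesis claims to
    exceed.\<close>
  have "card E1 \<le> card N \<or> card E2 \<le> card N"
    using red_or_blue_le_green by (simp add: card_ordered_pairs[OF fin] sub)
  moreover have "card E + card N = card V choose 2"
  proof -
    have "E \<subseteq> nsets V 2" "finite (nsets V 2)"
      using assms(1) by (auto simp: simple_graph_def finite_imp_finite_nsets)
    then show ?thesis
      unfolding N_def using card_nsets[of V 2]
      by (metis card_Diff_subset card_mono finite_subset le_add_diff_inverse)
  qed
  ultimately show False
    using assms(4) by linarith
qed

end
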